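(* There is a universal constant $c>0$ such that the following holds for every integer $d\ge 1$. There is an instance space $\mathcal{X}$ such that, if $\mathcal{F}$ denotes the family of all concept classes $\mathcal{C}\subseteq\{0,1\}^{\mathcal{X}}$ with Littlestone dimension $d$, then for all sufficiently large $T$ (depending on $d$), every (possibly randomized) online learner $\mathcal{A}$ in the realizable setting whose access to the concept class is through the agnostic ERM oracle and which makes a finite number of oracle queries satisfies $$M(\mathcal{A},T)\ \ge\ c\,2^{d},$$ i.e. it incurs $\Omega(2^{d})$ expected mistakes in the worst case.
   Context: Online learning with oracle access. Let $\mathcal{X}$ be an instance space and $\mathcal{F}$ a family of (nonempty) concept classes $\mathcal{C}\subseteq\{0,1\}^{\mathcal{X}}$. The learner knows $\mathcal{X}$, $\mathcal{F}$ and the horizon $T$. An oblivious adversary fixes in advance an unknown class $\mathcal{C}\in\mathcal{F}$, a target $c\in\mathcal{C}$ and a sequence $x_{1:T}\in\mathcal{X}^T$ (none of these depends on the learner's queries or predictions). The learner can access $\mathcal{C}$ only by querying an oracle $\mathcal{O}=\mathcal{O}(\mathcal{C})$. In round $t=1,\dots,T$: the learner observes $x_t$, may make oracle queries, picks a distribution on $\{0,1\}$ and predicts $\hat y_t$ drawn from it; then the true label $y_t$ is revealed. In the realizable setting $y_t=c(x_t)$. The number of mistakes is $M(\mathcal{A},\mathcal{O}(\mathcal{C}),x_{1:T},c)=\sum_{t=1}^T\mathbb{I}[\hat y_t\ne c(x_t)]$ and $$M(\mathcal{A},T)=\sup_{\mathcal{C}\in\mathcal{F}}\sup_{c\in\mathcal{C}}\sup_{x_{1:T}\in\mathcal{X}^T}\mathbb{E}[M(\mathcal{A},\mathcal{O}(\mathcal{C}),x_{1:T},c)],$$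 the expectation being over the learner's randomness. Agnostic ERM oracle: given any finite $S\subset\mathcal{X}\times\{0,1\}$, it returns some $c'\in\mathcal{C}$ minimizing $\sum_{(x,y)\in S}\mathbb{I}[c'(x)\ne y]$ over $\mathcal{C}$. When several answers are valid, the choice may be made adversarially, i.e. worst-case quantities are also worst case over valid oracles. Littlestone dimension of $\mathcal{C}$: the largest depth $n$ of a complete binary tree whose internal nodes are labeled by points of $\mathcal{X}$ such that for every root-to-leaf path, with edge labels $y_1,\dots,y_n\in\{0,1\}$ and visited nodes $x_1,\dots,x_n$, some $c\in\mathcal{C}$ has $c(x_i)=y_i$ for all $i$. *)

theory Defs
  imports "HOL-Probability.Probability"
begin

section \<open>Concept classes, Littlestone dimension, empirical risk minimization\<close>

text \<open>A concept on the instance space \<open>X\<close> is an element of \<open>X \<rightarrow>\<^sub>E UNIV\<close>, where \<open>True\<close> and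
  \<open>False\<close> stand for the labels 1 and 0.\<close>

type_synonym 'x concept = "'x \<Rightarrow> bool"
type_synonym 'x sample = "('x \<times> bool) set"

definition concept_class :: "'x set \<Rightarrow> 'x concept set \<Rightarrow> bool" where
  "concept_class X C \<longleftrightarrow> C \<noteq> {} \<and> C \<subseteq> (X \<rightarrow>\<^sub>E UNIV)"

text \<open>A complete binary tree of depth \<open>n\<close> is a labelling \<open>v\<close> of its internal nodes; a node is
  addressed by the list (of length less than \<open>n\<close>) of edge labels on the way from the root, and
  a root-to-leaf path is a list of length \<open>n\<close>.\<close>

definition shatters_tree :: "'x set \<Rightarrow> 'x concept set \<Rightarrow> nat \<Rightarrow> (bool list \<Rightarrow> 'x) \<Rightarrow> bool" where
  "shatters_tree X C n v \<longleftrightarrow>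
     (\<forall>p. length p < n \<longrightarrow> v p \<in> X) \<and>
     (\<forall>ys. length ys = n \<longrightarrow> (\<exists>c\<in>C. \<forall>i<n. c (v (take i ys)) = ys ! i))"

definition littlestone_dim :: "'x set \<Rightarrow> 'x concept set \<Rightarrow> enat" where
  "littlestone_dim X C = (SUP n \<in> {n. \<exists>v. shatters_tree X C n v}. enat n)"

definition littlestone_family :: "'x set \<Rightarrow> nat \<Rightarrow> 'x concept set set" where
  "littlestone_family X d = {C. concept_class X C \<and> littlestone_dim X C = enat d}"

definition empirical_error :: "'x concept \<Rightarrow> 'x sample \<Rightarrow> nat" where
  "empirical_error c S = (\<Sum>(x, y)\<in>S. of_bool (c x \<noteq> y))"

definition agnostic_erm :: "'x set \<Rightarrow> 'x concept set \<Rightarrow> ('x sample \<Rightarrow> 'x concept) \<Rightarrow> bool" where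
  "agnostic_erm X C erm \<longleftrightarrow>
     (\<forall>S. finite S \<and> S \<subseteq> X \<times> UNIV \<longrightarrow>
        erm S \<in> C \<and> (\<forall>c\<in>C. empirical_error (erm S) S \<le> empirical_error c S))"


section \<open>The online game\<close>

datatype 'x action = Query "'x sample" | Predict "bool pmf"

datatype 'x event =
    Instance 'x
  | Answer "'x sample" "'x concept"
  | Predicted "bool pmf" bool
  | Label bool

text \<open>A learner chooses its next action at random, depending on everything that has happened so
  far (in chronological order). If the instance space is countable there are only countably many
  samples, so discrete distributions lose no generality in the choice of queries.\<close>

type_synonym 'x learner = "'x event list \<Rightarrow> 'x action pmf"

text \<open>One round, after the instance has been revealed: the learner keeps querying until it
  predicts. The result consists of the prediction and the extended history; the missing
  probability mass is the probability that the learner queries forever.\<close>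

partial_function (spmf) play_round ::
  "'x learner \<Rightarrow> ('x sample \<Rightarrow> 'x concept) \<Rightarrow> 'x event list \<Rightarrow> (bool \<times> 'x event list) spmf"
where
  "play_round A erm h =
     bind_spmf (spmf_of_pmf (A h)) (\<lambda>a. case a of
         Query S \<Rightarrow> play_round A erm (h @ [Answer S (erm S)])
       | Predict p \<Rightarrow> map_spmf (\<lambda>y. (y, h @ [Predicted p y])) (spmf_of_pmf p))"

text \<open>The number of mistakes on the remaining instances, for target \<open>c\<close> and history \<open>h\<close>.\<close>

primrec play ::
  "'x learner \<Rightarrow> ('x sample \<Rightarrow> 'x concept) \<Rightarrow> 'x concept \<Rightarrow> 'x list \<Rightarrow> 'x event list \<Rightarrow> nat spmf"
where
  "play A erm c [] h = return_spmf 0"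
| "play A erm c (x # xs) h =
     bind_spmf (play_round A erm (h @ [Instance x])) (\<lambda>(y, h').
       map_spmf (\<lambda>m. of_bool (y \<noteq> c x) + m) (play A erm c xs (h' @ [Label (c x)])))"

definition expected_mistakes ::
  "'x learner \<Rightarrow> ('x sample \<Rightarrow> 'x concept) \<Rightarrow> 'x concept \<Rightarrow> 'x list \<Rightarrow> ennreal"
where
  "expected_mistakes A erm c xs = (\<integral>\<^sup>+ m. of_nat m \<partial>measure_spmf (play A erm c xs []))"

definition worst_case_mistakes ::
  "'x set \<Rightarrow> 'x concept set set \<Rightarrow> 'x learner \<Rightarrow> nat \<Rightarrow> ennreal"
where
  "worst_case_mistakes X F A T =
     (SUP C \<in> F. SUP erm \<in> {erm. agnostic_erm X C erm}. SUP c \<in> C.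
        SUP xs \<in> {xs. set xs \<subseteq> X \<and> length xs = T}. expected_mistakes A erm c xs)"

text \<open>All queries are legal, and whatever the adversary does, the total number of queries is
  finite with probability 1. No bound on this number, uniform or otherwise, is required.\<close>

definition finite_query_learner ::
  "'x set \<Rightarrow> 'x concept set set \<Rightarrow> nat \<Rightarrow> 'x learner \<Rightarrow> bool"
where
  "finite_query_learner X F T A \<longleftrightarrow>
     (\<forall>h S. Query S \<in> set_pmf (A h) \<longrightarrow> finite S \<and> S \<subseteq> X \<times> UNIV) \<and>
     (\<forall>C\<in>F. \<forall>erm. agnostic_erm X C erm \<longrightarrow>
        (\<forall>c\<in>C. \<forall>xs. set xs \<subseteq> X \<and> length xs = T \<longrightarrow> lossless_spmf (play A erm c xs [])))"

end

theory Submission imports Defs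
begin

text \<open>All concepts vanish outside \<open>{..<d}\<close> and a hidden sequence of \<open>N = 2^(d-1)\<close> points. Whatever
  the labels \<open>y\<^sub>0, \<dots>, y\<^sub>i\<^sub>-\<^sub>1\<close> so far, the class contains them extended by 0 and also extended by
  1 at \<open>x\<^sub>i\<close> and 0 afterwards; hence an agnostic ERM oracle can answer every query that avoids
  \<open>x\<^sub>i\<^sub>+\<^sub>1, x\<^sub>i\<^sub>+\<^sub>2, \<dots>\<close> without using \<open>y\<^sub>i\<close>. There are only \<open>N\<close> concepts of this kind; together with all
  concepts supported on \<open>{..<d}\<close> they form a class in which at most \<open>2^(d-1)\<close> concepts are true at
  any given point, and this bounds the Littlestone dimension by \<open>d\<close>.

  The adversary knows the learner and fixes the sequence greedily. Since the learner makes finitely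
  many queries, up to probability 1/2 they stay below some bound, and all later \<open>x\<^sub>j\<close> are chosen
  beyond it; \<open>y\<^sub>i\<close> is the label predicted with the smaller probability on this event. So every one
  of the \<open>N\<close> rounds costs at least 1/4 mistake in expectation.\<close>

section \<open>The hidden class\<close>

text \<open>These keep the Littlestone dimension at least \<open>d\<close> and supply the zero
  concept, whatever the hidden points and labels are.\<close>

definition low_concepts :: "nat \<Rightarrow> nat concept set" where
  "low_concepts d = {c. \<forall>x. c x \<longrightarrow> x < d}"

definition zero_ext :: "'x list \<Rightarrow> bool list \<Rightarrow> 'x concept" where
  "zero_ext xs ys = (\<lambda>x. (x, True) \<in> set (zip xs ys))"

text \<open>Reads the points up to index \<open>i\<close> but the labels only below
  \<open>i\<close>, so it is fixed before \<open>ys ! i\<close> is chosen.\<close>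

definition branch :: "'x list \<Rightarrow> bool list \<Rightarrow> nat \<Rightarrow> 'x concept" where
  "branch xs ys i = (zero_ext (take i xs) (take i ys))(xs ! i := True)"

text \<open>Labels enter through branches alone, so \<open>ys\<close> may be one entry shorter than
  \<open>xs\<close>: the state after an instance is revealed and before its label is.\<close>

definition hidden_class :: "nat \<Rightarrow> nat list \<Rightarrow> bool list \<Rightarrow> nat concept set" where
  "hidden_class d xs ys = low_concepts d \<union> branch xs ys ` {..<length xs}"

text \<open>The concepts that differ from 0 on no hidden point later than those occurring in \<open>S\<close>. Up to
  their restriction to \<open>S\<close> they are the whole class, so an oracle may answer from them only.\<close>

definition visible_class :: "nat \<Rightarrow> nat list \<Rightarrow> bool list \<Rightarrow> nat sample \<Rightarrow> nat concept set" where
  "visible_class d xs ys S =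
     low_concepts d \<union> branch xs ys ` {i. \<exists>j\<ge>i. j < length xs \<and> xs ! j \<in> fst ` S}"

text \<open>Since \<open>arg_min\<close> is a fixed choice, equal visible classes yield equal
  answers to \<open>S\<close>.\<close>

definition lazy_erm :: "nat \<Rightarrow> nat list \<Rightarrow> bool list \<Rightarrow> nat sample \<Rightarrow> nat concept" where
  "lazy_erm d xs ys S = arg_min (\<lambda>c. empirical_error c S) (\<lambda>c. c \<in> visible_class d xs ys S)"

section \<open>Agnostic ERM through visible concepts\<close>

lemma empirical_error_cong:
  assumes "\<And>x. x \<in> fst ` S \<Longrightarrow> c x = c' x"
  shows "empirical_error c S = empirical_error c' S"
proof -
  have "c x = c' x" if "(x, y) \<in> S" for x y
    using assms[of x] that by force
  then show ?thesis
    unfolding empirical_error_def by (intro sum.cong) auto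
qed

lemma zero_concept_low: "(\<lambda>x. False) \<in> low_concepts d"
  by (simp add: low_concepts_def)

text \<open>A label 0 adds nothing to an extension by 0, and a label 1 is exactly the update in
  \<open>branch\<close>. So, starting from the zero concept, every new zero extension is a
  branch.\<close>

lemma zero_ext_take_Suc:
  assumes "i < length xs" "i < length ys"
  shows "zero_ext (take (Suc i) xs) (take (Suc i) ys) =
    (if ys ! i then branch xs ys i else zero_ext (take i xs) (take i ys))"
  using assms by (auto simp: zero_ext_def branch_def take_Suc_conv_app_nth fun_eq_iff)

lemma zero_ext_in_hidden_class:
  assumes "length ys = length xs"
  shows "zero_ext xs ys \<in> hidden_class d xs ys"
proof -
  have "zero_ext (take i xs) (take i ys) \<in> hidden_class d xs ys" if "i \<le> length xs" for i
    using that
  proof (induction i)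
    case 0
    show ?case by (simp add: zero_ext_def hidden_class_def zero_concept_low)
  next
    case (Suc i)
    then show ?case
      using zero_ext_take_Suc[of i xs ys] assms by (auto simp: hidden_class_def)
  qed
  from this[of "length xs"] show ?thesis using assms by simp
qed

lemma zero_ext_nth:
  assumes "distinct xs" "i < length xs" "length ys = length xs"
  shows "zero_ext xs ys (xs ! i) = ys ! i"
  using assms by (auto simp: zero_ext_def set_zip nth_eq_iff_index_eq)

text \<open>Both \<open>branch xs ys i\<close> and the next zero extension differ from the zero
  extension of the first \<open>i\<close> labels at most at \<open>xs ! i\<close>. If this point
  occurs in \<open>S\<close>, the branch is visible itself; otherwise the difference cannot be seen
  on \<open>S\<close>, and induction goes down to a shorter prefix.\<close>

lemma visible_represents:
  assumes len: "length xs \<le> Suc (length ys)" and c: "c \<in> hidden_class d xs ys"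
  shows "\<exists>c'\<in>visible_class d xs ys S. \<forall>x\<in>fst ` S. c' x = c x"
proof -
  have ext: "\<exists>c'\<in>visible_class d xs ys S. \<forall>x\<in>fst ` S. c' x = zero_ext (take i xs) (take i ys) x"
    if "i < length xs" for i
    using that
  proof (induction i)
    case 0
    show ?case
      by (rule bexI[of _ "\<lambda>x. False"]) (auto simp: zero_ext_def visible_class_def zero_concept_low)
  next
    case (Suc i)
    from Suc.IH Suc.prems obtain c' where c': "c' \<in> visible_class d xs ys S"
      "\<forall>x\<in>fst ` S. c' x = zero_ext (take i xs) (take i ys) x" by auto
    have e: "zero_ext (take (Suc i) xs) (take (Suc i) ys) =
      (if ys ! i then branch xs ys i else zero_ext (take i xs) (take i ys))"
      using Suc.prems len by (intro zero_ext_take_Suc) auto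
    show ?case
    proof (cases "xs ! i \<in> fst ` S")
      case True
      then have "branch xs ys i \<in> visible_class d xs ys S"
        using Suc.prems by (auto simp: visible_class_def intro!: imageI exI[of _ i])
      with c' show ?thesis unfolding e by (cases "ys ! i") auto
    next
      case False
      then have "\<forall>x\<in>fst ` S. branch xs ys i x = zero_ext (take i xs) (take i ys) x"
        unfolding branch_def by (metis fun_upd_apply)
      with c' show ?thesis unfolding e by (cases "ys ! i") auto
    qed
  qed
  from c consider "c \<in> low_concepts d" | i where "i < length xs" "c = branch xs ys i"
    by (auto simp: hidden_class_def)
  then show ?thesis
  proof cases
    case 1
    then show ?thesis by (intro bexI[of _ c]) (auto simp: visible_class_def)
  next
    case 2
    show ?thesis
    proof (cases "xs ! i \<in> fst ` S")
      case True
      then have "branch xs ys i \<in> visible_class d xs ys S"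
        using 2 by (auto simp: visible_class_def intro!: imageI exI[of _ i])
      with 2(2) show ?thesis by blast
    next
      case False
      then have "\<forall>x\<in>fst ` S. branch xs ys i x = zero_ext (take i xs) (take i ys) x"
        unfolding branch_def by (metis fun_upd_apply)
      with ext[OF 2(1)] 2(2) show ?thesis by simp
    qed
  qed
qed

lemma visible_subset_hidden: "visible_class d xs ys S \<subseteq> hidden_class d xs ys"
  by (auto simp: visible_class_def hidden_class_def)

text \<open>Every concept of the class agrees on \<open>S\<close> with a visible one, so a minimizer
  over the visible concepts is a minimizer over the whole class.\<close>

lemma agnostic_erm_lazy_erm:
  assumes "length xs \<le> Suc (length ys)"
  shows "agnostic_erm UNIV (hidden_class d xs ys) (lazy_erm d xs ys)"
  unfolding agnostic_erm_def
proof (intro allI impI conjI ballI)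
  fix S :: "nat sample"
  have "(\<lambda>x. False) \<in> visible_class d xs ys S"
    by (simp add: visible_class_def zero_concept_low)
  then have "lazy_erm d xs ys S \<in> visible_class d xs ys S"
    unfolding lazy_erm_def by (rule arg_min_natI[where P = "\<lambda>c. c \<in> visible_class d xs ys S"])
  then show "lazy_erm d xs ys S \<in> hidden_class d xs ys"
    using visible_subset_hidden by blast
  fix c assume "c \<in> hidden_class d xs ys"
  then obtain c' where c': "c' \<in> visible_class d xs ys S" "\<forall>x\<in>fst ` S. c' x = c x"
    using visible_represents[OF assms] by blast
  have "empirical_error (lazy_erm d xs ys S) S \<le> empirical_error c' S"
    unfolding lazy_erm_def by (rule arg_min_nat_le[where P = "\<lambda>c. c \<in> visible_class d xs ys S"]) (fact c'(1))
  also have "\<dots> = empirical_error c S"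
    using c'(2) by (intro empirical_error_cong) auto
  finally show "empirical_error (lazy_erm d xs ys S) S \<le> empirical_error c S" .
qed

text \<open>The label \<open>ys ! t\<close> of the newest instance has disappeared from the right-hand side.\<close>

lemma lazy_erm_prefix:
  assumes t: "t < length xs" and fresh: "\<And>j. t < j \<Longrightarrow> j < length xs \<Longrightarrow> xs ! j \<notin> fst ` S"
  shows "lazy_erm d xs ys S = lazy_erm d (take (Suc t) xs) (take t ys) S"
proof -
  let ?xs = "take (Suc t) xs"
  have I: "{i. \<exists>j\<ge>i. j < length xs \<and> xs ! j \<in> fst ` S} =
    {i. \<exists>j\<ge>i. j < length ?xs \<and> ?xs ! j \<in> fst ` S}" (is "?I = ?J")
  proof (intro equalityI subsetI)
    fix i assume "i \<in> ?I"
    then obtain j where j: "j \<ge> i" "j < length xs" "xs ! j \<in> fst ` S" by auto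
    with fresh[of j] have "j \<le> t" by (meson not_le)
    with j show "i \<in> ?J" by (simp add: exI[of _ j])
  next
    fix i assume "i \<in> ?J"
    then obtain j where "j \<ge> i" "j < length ?xs" "?xs ! j \<in> fst ` S" by blast
    then show "i \<in> ?I" by (simp add: exI[of _ j])
  qed
  \<comment> \<open>A branch with index \<open>i\<close> \<le> \<open>t\<close> reads labels below
    \<open>i\<close> only, hence never \<open>ys ! t\<close>.\<close>
  have "branch xs ys i = branch ?xs (take t ys) i" if "i \<in> ?J" for i
  proof -
    from that have "i \<le> t" by auto
    then show ?thesis by (simp add: branch_def min_absorb1)
  qed
  then have "branch xs ys ` ?J = branch ?xs (take t ys) ` ?J"
    by (rule image_cong[OF refl])
  then have "visible_class d xs ys S = visible_class d ?xs (take t ys) S"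
    unfolding visible_class_def I by (rule arg_cong)
  then show ?thesis by (simp add: lazy_erm_def)
qed

section \<open>Littlestone dimension of the hidden class\<close>

lemma shatters_tree_card:
  assumes sh: "shatters_tree X C (Suc n) v" and fin: "finite C"
  shows "2 ^ n \<le> card {c\<in>C. c (v [])}"
proof -
  let ?L = "{zs::bool list. length zs = n}"
  \<comment> \<open>Only paths that leave the root along \<open>True\<close> are used, so all chosen
    concepts are true at the root; \<open>zs\<close> holds the remaining \<open>n\<close>
    labels.\<close>
  have "\<forall>zs. \<exists>c. length zs = n \<longrightarrow> c \<in> C \<and> (\<forall>i<Suc n. c (v (take i (True # zs))) = (True # zs) ! i)"
    using sh unfolding shatters_tree_def by (metis length_Cons)
  then obtain f where f: "\<And>zs. length zs = n \<Longrightarrow> f zs \<in> C"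
    "\<And>zs i. length zs = n \<Longrightarrow> i < Suc n \<Longrightarrow> f zs (v (take i (True # zs))) = (True # zs) ! i"
    by metis
  have inj: "inj_on f ?L"
  proof (rule inj_onI, rule ccontr)
    fix a b :: "bool list" assume a: "a \<in> ?L" and b: "b \<in> ?L" and eq: "f a = f b" and ne: "a \<noteq> b"
    let ?P = "\<lambda>i. i < n \<and> a ! i \<noteq> b ! i"
    \<comment> \<open>Up to their first difference the two paths visit the same nodes, and one
      concept cannot carry both labels at the node where they part.\<close>
    define i where "i = (LEAST i. ?P i)"
    have "\<exists>i. ?P i" using a b ne by (auto simp: list_eq_iff_nth_eq)
    then have i: "?P i" unfolding i_def by (rule LeastI_ex)
    have less: "a ! j = b ! j" if "j < i" for j
      using not_less_Least[of j ?P] that i unfolding i_def by auto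
    have "take i a = take i b"
      using a b i less by (auto simp: list_eq_iff_nth_eq)
    then have "(True # a) ! Suc i = (True # b) ! Suc i"
      using f(2)[of a "Suc i"] f(2)[of b "Suc i"] a b i eq by simp
    with i show False by simp
  qed
  have "f ` ?L \<subseteq> {c\<in>C. c (v [])}"
    using f(1) f(2)[of _ 0] by auto
  then have "card ?L \<le> card {c\<in>C. c (v [])}"
    using fin inj by (intro card_inj_on_le) auto
  moreover have "card ?L = 2 ^ n"
    using card_lists_length_eq[of "UNIV :: bool set" n] by simp
  ultimately show ?thesis by simp
qed

lemma low_concepts_Collect: "low_concepts d = (\<lambda>B x. x \<in> B) ` Pow {..<d}"
proof (intro equalityI subsetI)
  fix c assume "c \<in> low_concepts d"
  then have "Collect c \<in> Pow {..<d}" "c = (\<lambda>x. x \<in> Collect c)" by (auto simp: low_concepts_def)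
  then show "c \<in> (\<lambda>B x. x \<in> B) ` Pow {..<d}" by blast
qed (auto simp: low_concepts_def)

lemma finite_hidden_class: "finite (hidden_class d xs ys)"
  by (simp add: hidden_class_def low_concepts_Collect)

lemma card_low_concepts_through:
  assumes "r < d"
  shows "card {c\<in>low_concepts d. c r} \<le> 2 ^ (d - 1)"
proof -
  have "{c\<in>low_concepts d. c r} \<subseteq> (\<lambda>B x. x \<in> insert r B) ` Pow ({..<d} - {r})"
  proof
    fix c assume c: "c \<in> {c\<in>low_concepts d. c r}"
    then have "Collect c - {r} \<in> Pow ({..<d} - {r})" "c = (\<lambda>x. x \<in> insert r (Collect c - {r}))"
      by (auto simp: low_concepts_def)
    then show "c \<in> (\<lambda>B x. x \<in> insert r B) ` Pow ({..<d} - {r})" by blast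
  qed
  then have "card {c\<in>low_concepts d. c r} \<le> card ((\<lambda>B x. x \<in> insert r B) ` Pow ({..<d} - {r}))"
    by (intro card_mono) auto
  also have "\<dots> \<le> card (Pow ({..<d} - {r}))" by (intro card_image_le) auto
  also have "\<dots> = 2 ^ (d - 1)" using assms by (simp add: card_Pow)
  finally show ?thesis .
qed

lemma branch_high:
  assumes "set xs \<subseteq> {d..}" "i < length xs" "branch xs ys i x"
  shows "d \<le> x"
proof (cases "x = xs ! i")
  case True
  then show ?thesis using assms(1,2) nth_mem by force
next
  case False
  with assms(3) have "x \<in> set (take i xs)"
    by (auto simp: branch_def zero_ext_def dest: set_zip_leftD)
  then show ?thesis using assms(1) set_take_subset by force
qed

text \<open>Low concepts live below \<open>d\<close> and branches at \<open>d\<close> or above, so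
  only one of the two kinds can be true at \<open>r\<close>. This is why the class has room for
  \<open>2 ^ (d - 1)\<close> branches.\<close>

lemma card_hidden_class_through:
  assumes "set xs \<subseteq> {d..}" "length xs \<le> 2 ^ (d - 1)"
  shows "card {c\<in>hidden_class d xs ys. c r} \<le> 2 ^ (d - 1)"
proof (cases "r < d")
  case True
  then have "{c\<in>hidden_class d xs ys. c r} = {c\<in>low_concepts d. c r}"
    using branch_high[OF assms(1), of _ ys r] by (auto simp: hidden_class_def)
  then show ?thesis using card_low_concepts_through[OF True] by simp
next
  case False
  then have "{c\<in>hidden_class d xs ys. c r} \<subseteq> branch xs ys ` {..<length xs}"
    by (auto simp: hidden_class_def low_concepts_def)
  then have "card {c\<in>hidden_class d xs ys. c r} \<le> card (branch xs ys ` {..<length xs})"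
    by (intro card_mono) auto
  also have "\<dots> \<le> length xs" using card_image_le[of "{..<length xs}"] by simp
  finally show ?thesis using assms(2) by simp
qed

lemma hidden_class_in_family:
  assumes "d \<ge> 1" "set xs \<subseteq> {d..}" "length xs \<le> 2 ^ (d - 1)"
  shows "hidden_class d xs ys \<in> littlestone_family UNIV d"
proof -
  let ?C = "hidden_class d xs ys"
  have le: "n \<le> d" if "shatters_tree UNIV ?C n v" for n v
  proof (cases n)
    case (Suc m)
    with that have "2 ^ m \<le> card {c\<in>?C. c (v [])}"
      using shatters_tree_card finite_hidden_class by blast
    also have "\<dots> \<le> 2 ^ (d - 1)" by (rule card_hidden_class_through[OF assms(2,3)])
    finally have "m \<le> d - 1" by simp
    with Suc assms(1) show ?thesis by simp
  qed simp
  \<comment> \<open>Every node at depth \<open>i\<close> is labelled by the point \<open>i\<close>,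
    so a low concept spells out any given path.\<close>
  have "shatters_tree UNIV ?C d length"
    unfolding shatters_tree_def
  proof (intro conjI allI impI)
    fix ys' :: "bool list" assume l: "length ys' = d"
    show "\<exists>c\<in>?C. \<forall>i<d. c (length (take i ys')) = ys' ! i"
      using l by (intro bexI[of _ "\<lambda>x. x < d \<and> ys' ! x"])
        (auto simp: hidden_class_def low_concepts_def)
  qed simp
  then have "littlestone_dim UNIV ?C = enat d"
    unfolding littlestone_dim_def using le by (intro antisym SUP_least SUP_upper) auto
  moreover have "concept_class UNIV ?C"
    using zero_concept_low by (auto simp: concept_class_def hidden_class_def)
  ultimately show ?thesis by (simp add: littlestone_family_def)
qed

section \<open>Probabilities of histories\<close>

definition queries :: "'x event list \<Rightarrow> 'x sample set" where
  "queries h = {S. \<exists>a. Answer S a \<in> set h}"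

lemma queries_append [simp]: "queries (h @ h') = queries h \<union> queries h'"
  by (auto simp: queries_def)

text \<open>Fixpoint induction; admissibility holds because the support of the supremum of a chain
  is the union of the supports. Histories grow strictly, and each recorded query is one the learner
  can issue, so legality of queries passes to histories.\<close>

lemma set_play_round:
  assumes "r \<in> set_spmf (play_round A erm h)"
  shows "\<exists>e. snd r = h @ e \<and> e \<noteq> [] \<and> (\<forall>S\<in>queries e. \<exists>g. Query S \<in> set_pmf (A g))"
  using assms
proof (induction arbitrary: A erm h r rule: play_round.fixp_induct)
  case 1
  show ?case
  proof (intro ccpo.admissibleI allI impI)
    fix Y :: "(_ \<Rightarrow> (bool \<times> 'a event list) spmf) set" and A :: "'a learner" and erm h r
    assume chain: "Complete_Partial_Order.chain spmf.le_fun Y"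
      and IH: "\<forall>f\<in>Y. \<forall>A erm h r. r \<in> set_spmf (curry (curry f) A erm h) \<longrightarrow>
        (\<exists>e. snd r = h @ e \<and> e \<noteq> [] \<and> (\<forall>S\<in>queries e. \<exists>g. Query S \<in> set_pmf (A g)))"
      and r: "r \<in> set_spmf (curry (curry (spmf.lub_fun Y)) A erm h)"
    have "Complete_Partial_Order.chain (ord_spmf (=)) {g. \<exists>f\<in>Y. g = f ((A, erm), h)}"
      by (rule chain_fun) (use chain in simp)
    with r obtain f where "f \<in> Y" "r \<in> set_spmf (curry (curry f) A erm h)"
      by (auto simp: fun_lub_def set_lub_spmf)
    with IH show "\<exists>e. snd r = h @ e \<and> e \<noteq> [] \<and> (\<forall>S\<in>queries e. \<exists>g. Query S \<in> set_pmf (A g))"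
      by blast
  qed
next
  case 2
  then show ?case by simp
next
  case (3 f A erm h r)
  from 3(2) obtain a where a: "a \<in> set_pmf (A h)"
    "r \<in> set_spmf (case a of Query S \<Rightarrow> f A erm (h @ [Answer S (erm S)])
       | Predict p \<Rightarrow> map_spmf (\<lambda>y. (y, h @ [Predicted p y])) (spmf_of_pmf p))"
    by (auto simp: set_bind_spmf simp del: bind_spmf_of_pmf map_spmf_of_pmf)
  show ?case
  proof (cases a)
    case (Query S)
    with a have "r \<in> set_spmf (f A erm (h @ [Answer S (erm S)]))" by simp
    from 3(1)[OF this] obtain e where "snd r = (h @ [Answer S (erm S)]) @ e"
      "\<forall>S\<in>queries e. \<exists>g. Query S \<in> set_pmf (A g)" by blast
    then show ?thesis using a Query
      by (intro exI[of _ "Answer S (erm S) # e"]) (auto simp: queries_def)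
  next
    case (Predict p)
    with a show ?thesis by (auto simp: queries_def)
  qed
qed

text \<open>Products are compared because the first factors may disagree wherever the continuation
  cannot reach \<open>z\<close>.\<close>

lemma spmf_bind_cong_at:
  assumes "\<And>y. spmf p y * spmf (f y) z = spmf q y * spmf (g y) z"
  shows "spmf (p \<bind> f) z = spmf (q \<bind> g) z"
proof -
  have "ennreal (spmf (p \<bind> f) z) = ennreal (spmf (q \<bind> g) z)"
    unfolding ennreal_spmf_bind nn_integral_measure_spmf
    by (intro nn_integral_cong) (simp add: assms flip: ennreal_mult'')
  then show ?thesis by simp
qed

section \<open>Measures of discrete subprobabilities\<close>

lemma nn_integral_bind_spmf:
  "(\<integral>\<^sup>+ z. f z \<partial>measure_spmf (p \<bind> q)) = (\<integral>\<^sup>+ y. (\<integral>\<^sup>+ z. f z \<partial>measure_spmf (q y)) \<partial>measure_spmf p)"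
  unfolding measure_spmf_bind
  by (subst nn_integral_bind[where B = "count_space UNIV"]) (simp_all add: o_def)

lemma emeasure_bind_spmf:
  "emeasure (measure_spmf (p \<bind> q)) B = (\<integral>\<^sup>+ y. emeasure (measure_spmf (q y)) B \<partial>measure_spmf p)"
  using nn_integral_bind_spmf[where f = "indicator B" and p = p and q = q] by simp

lemma emeasure_lossless_spmf: "lossless_spmf p \<Longrightarrow> emeasure (measure_spmf p) UNIV = 1"
  by (simp add: lossless_spmf_def weight_spmf_def measure_spmf.emeasure_eq_measure)

lemma ennreal_half: "ennreal (1 / 2) = 1 / 2"
  using ennreal_divide_numeral[of 1 "num.Bit0 num.One"] by simp

lemma half_less_one: "1 / 2 < (1 :: ennreal)"
proof -
  have "ennreal (1 / 2) < ennreal 1" by (subst ennreal_less_iff) simp_all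
  then show ?thesis by (simp only: ennreal_half ennreal_1)
qed

lemma ennreal_half_quarter:
  assumes "1 / 2 < a + b"
  shows "1 / 4 \<le> a \<or> 1 / 4 \<le> (b :: ennreal)"
proof (rule ccontr)
  assume "\<not> ?thesis"
  then have "a + b \<le> 1 / 4 + 1 / 4" by (intro add_mono) auto
  also have "(1 / 4 + 1 / 4 :: ennreal) = ennreal (1 / 4) + ennreal (1 / 4)"
    using ennreal_divide_numeral[of 1 "num.Bit0 (num.Bit0 num.One)"] by simp
  also have "\<dots> = ennreal (1 / 2)" by (simp flip: ennreal_plus)
  also have "\<dots> = 1 / 2" by (rule ennreal_half)
  finally show False using assms by simp
qed

lemma emeasure_spmf_cong:
  assumes "\<And>z. z \<in> B \<Longrightarrow> spmf p z = spmf q z"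
  shows "emeasure (measure_spmf p) B = emeasure (measure_spmf q) B"
proof -
  have "(\<integral>\<^sup>+ z. indicator B z \<partial>measure_spmf p) = (\<integral>\<^sup>+ z. indicator B z \<partial>measure_spmf q)"
    unfolding nn_integral_measure_spmf
    using assms by (intro nn_integral_cong) (simp split: split_indicator)
  then show ?thesis by simp
qed

text \<open>A history records the queries that produced it, so its probability does not depend on the
  answers to other queries.\<close>

lemma spmf_play_round_cong:
  assumes "\<forall>S\<in>queries h'. erm S = erm' S"
  shows "spmf (play_round A erm h) (y, h') = spmf (play_round A erm' h) (y, h')"
proof -
  have ext: "\<exists>e. h' = h @ e \<and> e \<noteq> []" if "spmf (play_round A erm h) (y, h') \<noteq> 0" for erm h
    using set_play_round[of "(y, h')" A erm h] that by (auto simp: spmf_eq_0_set_spmf)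
  \<comment> \<open>The learner may query forever, so the induction is on a bound for the events
    still missing from \<open>h'\<close>. With none missing both sides vanish, as a round appends at
    least one event.\<close>
  have "length h' \<le> length h + n \<Longrightarrow> ?thesis" for n
  proof (induction n arbitrary: h)
    case 0
    have "spmf (play_round A erm h) (y, h') = 0" for erm
      using ext[of erm h] 0 by fastforce
    then show ?case by metis
  next
    case (Suc n)
    show ?case
      unfolding play_round.simps[of A erm h] play_round.simps[of A erm' h]
    proof (rule spmf_bind_cong_at, rule arg_cong2[where f = "(*)"])
      fix a
      show "spmf (case a of Query S \<Rightarrow> play_round A erm (h @ [Answer S (erm S)])
          | Predict p \<Rightarrow> map_spmf (\<lambda>y. (y, h @ [Predicted p y])) (spmf_of_pmf p)) (y, h') =
        spmf (case a of Query S \<Rightarrow> play_round A erm' (h @ [Answer S (erm' S)])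
          | Predict p \<Rightarrow> map_spmf (\<lambda>y. (y, h @ [Predicted p y])) (spmf_of_pmf p)) (y, h')"
      proof (cases a)
        case (Query S)
        have IH: "spmf (play_round A erm (h @ [Answer S (erm S)])) (y, h') =
          spmf (play_round A erm' (h @ [Answer S (erm S)])) (y, h')"
          by (rule Suc.IH) (use Suc.prems in simp)
        show ?thesis
        proof (cases "S \<in> queries h'")
          case True
          with assms Query IH show ?thesis by simp
        next
          case False
          \<comment> \<open>This query would leave a record that \<open>h'\<close> lacks, so
            \<open>h'\<close> is out of reach whatever the answer \<open>b\<close> is.\<close>
          then have "spmf (play_round A erm (h @ [Answer S b])) (y, h') = 0" for erm b
            using ext[of erm "h @ [Answer S b]"] by (fastforce simp: queries_def)
          with Query show ?thesis by simp
        qed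
      qed simp
    qed simp
  qed
  from this[of "length h'"] show ?thesis by simp
qed

text \<open>Labels come from \<open>zs\<close> and not from a target, since the adversary analyses
  the round of \<open>x\<close> before the final target is known. The run stops before the label of
  \<open>x\<close> is revealed.\<close>

primrec round_after ::
  "'x learner \<Rightarrow> ('x sample \<Rightarrow> 'x concept) \<Rightarrow> ('x \<times> bool) list \<Rightarrow> 'x \<Rightarrow> 'x event list
    \<Rightarrow> (bool \<times> 'x event list) spmf"
where
  "round_after A erm [] x h = play_round A erm (h @ [Instance x])"
| "round_after A erm (z # zs) x h =
     bind_spmf (play_round A erm (h @ [Instance (fst z)]))
       (\<lambda>(y, h'). round_after A erm zs x (h' @ [Label (snd z)]))"

lemma set_round_after:
  assumes "r \<in> set_spmf (round_after A erm zs x h)"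
  shows "\<exists>e. snd r = h @ e \<and> (\<forall>S\<in>queries e. \<exists>g. Query S \<in> set_pmf (A g))"
  using assms
proof (induction zs arbitrary: h)
  case Nil
  then show ?case using set_play_round[of r A erm "h @ [Instance x]"]
    by (force simp: queries_def)
next
  case (Cons z zs)
  from Cons.prems obtain y h1 where *: "(y, h1) \<in> set_spmf (play_round A erm (h @ [Instance (fst z)]))"
    "r \<in> set_spmf (round_after A erm zs x (h1 @ [Label (snd z)]))"
    by (auto simp: set_bind_spmf)
  from set_play_round[OF *(1)] Cons.IH[OF *(2)] show ?case
    by (force simp: queries_def)
qed

text \<open>Rounds only append events, so an intermediate history that can lead to \<open>h'\<close>
  has no queries outside \<open>queries h'\<close>, and the single-round result applies to each
  round.\<close>

lemma spmf_round_after_cong: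
  assumes "\<forall>S\<in>queries h'. erm S = erm' S"
  shows "spmf (round_after A erm zs x h) (y, h') = spmf (round_after A erm' zs x h) (y, h')"
proof (induction zs arbitrary: h)
  case Nil
  show ?case by (simp add: spmf_play_round_cong[OF assms])
next
  case (Cons z zs)
  show ?case
    unfolding round_after.simps
  proof (rule spmf_bind_cong_at)
    fix r :: "bool \<times> 'a event list"
    obtain b h1 where r: "r = (b, h1)" by force
    let ?q = "\<lambda>erm. spmf (round_after A erm zs x (h1 @ [Label (snd z)])) (y, h')"
    have "spmf (play_round A erm (h @ [Instance (fst z)])) r =
      spmf (play_round A erm' (h @ [Instance (fst z)])) r" if "?q erm \<noteq> 0"
    proof -
      from that have "queries h1 \<subseteq> queries h'"
        using set_round_after[of "(y, h')" A erm zs x "h1 @ [Label (snd z)]"]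
        by (auto simp: spmf_eq_0_set_spmf)
      with assms show ?thesis unfolding r by (intro spmf_play_round_cong) auto
    qed
    with Cons.IH[of "h1 @ [Label (snd z)]"]
    show "spmf (play_round A erm (h @ [Instance (fst z)])) r *
        spmf (case r of (y, h') \<Rightarrow> round_after A erm zs x (h' @ [Label (snd z)])) (y, h') =
      spmf (play_round A erm' (h @ [Instance (fst z)])) r *
        spmf (case r of (y, h') \<Rightarrow> round_after A erm' zs x (h' @ [Label (snd z)])) (y, h')"
      by (auto simp: r)
  qed
qed

section \<open>Expected mistakes round by round\<close>

lemma lossless_round_after:
  assumes "lossless_spmf (play A erm c (xs @ x # zs) h)"
  shows "lossless_spmf (round_after A erm (map (\<lambda>x. (x, c x)) xs) x h)"
  using assms
proof (induction xs arbitrary: h)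
  case (Cons a xs)
  then show ?case by (fastforce simp: split_beta)
qed simp

text \<open>Linearity of expectation, by induction on the rounds: the first round contributes its
  mistake probability, and the rest is averaged over its outcome.\<close>

lemma sum_round_mistakes_le:
  assumes "lossless_spmf (play A erm c xs h)"
  shows "(\<Sum>i<length xs. emeasure (measure_spmf
      (round_after A erm (map (\<lambda>x. (x, c x)) (take i xs)) (xs ! i) h)) {r. fst r \<noteq> c (xs ! i)})
    \<le> (\<integral>\<^sup>+ m. of_nat m \<partial>measure_spmf (play A erm c xs h))"
  using assms
proof (induction xs arbitrary: h)
  case (Cons x xs)
  let ?p = "play_round A erm (h @ [Instance x])"
  let ?h = "\<lambda>r :: bool \<times> 'a event list. snd r @ [Label (c x)]"
  let ?e = "\<lambda>i h. emeasure (measure_spmf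
      (round_after A erm (map (\<lambda>x. (x, c x)) (take i xs)) (xs ! i) h)) {r. fst r \<noteq> c (xs ! i)}"
  let ?m = "\<lambda>h. \<integral>\<^sup>+ m. of_nat m \<partial>measure_spmf (play A erm c xs h)"
  have "(\<Sum>i<length (x # xs). emeasure (measure_spmf
      (round_after A erm (map (\<lambda>x. (x, c x)) (take i (x # xs))) ((x # xs) ! i) h))
      {r. fst r \<noteq> c ((x # xs) ! i)}) =
    emeasure (measure_spmf ?p) {r. fst r \<noteq> c x} + (\<Sum>i<length xs. \<integral>\<^sup>+ r. ?e i (?h r) \<partial>measure_spmf ?p)"
    by (simp add: sum.lessThan_Suc_shift emeasure_bind_spmf split_beta del: sum.lessThan_Suc)
  also have "\<dots> = (\<integral>\<^sup>+ r. indicator {r. fst r \<noteq> c x} r + (\<Sum>i<length xs. ?e i (?h r)) \<partial>measure_spmf ?p)"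
    by (simp add: nn_integral_add nn_integral_sum)
  also have "\<dots> \<le> (\<integral>\<^sup>+ r. indicator {r. fst r \<noteq> c x} r + ?m (?h r) \<partial>measure_spmf ?p)"
  proof (rule nn_integral_mono_AE, unfold AE_measure_spmf_iff, intro ballI add_left_mono)
    fix r assume "r \<in> set_spmf ?p"
    with Cons.prems have "lossless_spmf (play A erm c xs (?h r))" by (fastforce simp: split_beta)
    then show "(\<Sum>i<length xs. ?e i (?h r)) \<le> ?m (?h r)" by (rule Cons.IH)
  qed
  also have "\<dots> = (\<integral>\<^sup>+ r. (\<integral>\<^sup>+ m. of_bool (fst r \<noteq> c x) + of_nat m
      \<partial>measure_spmf (play A erm c xs (?h r))) \<partial>measure_spmf ?p)"
  proof (rule nn_integral_cong_AE, unfold AE_measure_spmf_iff, intro ballI)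
    fix r assume "r \<in> set_spmf ?p"
    with Cons.prems have "lossless_spmf (play A erm c xs (?h r))" by (fastforce simp: split_beta)
    \<comment> \<open>Total mass 1 allows the mistake of the current round, a constant here, to move
      under the inner integral.\<close>
    then have "emeasure (measure_spmf (play A erm c xs (?h r))) (space (measure_spmf (play A erm c xs (?h r)))) = 1"
      unfolding space_measure_spmf by (rule emeasure_lossless_spmf)
    then show "indicator {r. fst r \<noteq> c x} r + ?m (?h r) =
      (\<integral>\<^sup>+ m. of_bool (fst r \<noteq> c x) + of_nat m \<partial>measure_spmf (play A erm c xs (?h r)))"
      by (subst nn_integral_add) (auto simp: indicator_def simp del: space_measure_spmf)
  qed
  also have "\<dots> = (\<integral>\<^sup>+ m. of_nat m \<partial>measure_spmf (play A erm c (x # xs) h))"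
    by (simp add: nn_integral_bind_spmf split_beta o_def)
  finally show ?case .
qed simp

text \<open>A history contains finitely many queries, all finite here, so the events that all
  queried points are below \<open>m\<close> increase to an event of probability 1. Some
  \<open>m\<close> gives more than 1/2; one of the two predictions has at least 1/4 within that
  event, and \<open>b\<close> is the opposite label.\<close>

lemma likely_bounded_queries:
  fixes p :: "(bool \<times> nat event list) spmf"
  assumes "lossless_spmf p" and fin: "\<And>r S. r \<in> set_spmf p \<Longrightarrow> S \<in> queries (snd r) \<Longrightarrow> finite S"
  shows "\<exists>b m. 1 / 4 \<le> emeasure (measure_spmf p) {r. fst r \<noteq> b \<and> (\<forall>S\<in>queries (snd r). fst ` S \<subseteq> {..<m})}"
proof -
  let ?B = "\<lambda>m. {r :: bool \<times> nat event list. \<forall>S\<in>queries (snd r). fst ` S \<subseteq> {..<m}}"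
  have mono: "incseq ?B"
    by (rule incseq_SucI) (fastforce simp: subset_iff less_Suc_eq)
  have sup: "set_spmf p \<subseteq> (\<Union>m. ?B m)"
  proof
    fix r assume r: "r \<in> set_spmf p"
    have fq: "finite (queries h)" for h :: "nat event list"
    proof -
      have "queries h \<subseteq> (\<lambda>e. case e of Answer S a \<Rightarrow> S | _ \<Rightarrow> {}) ` set h"
        by (force simp: queries_def)
      then show ?thesis by (rule finite_subset) simp
    qed
    have "finite (\<Union>S\<in>queries (snd r). fst ` S)" using fin[OF r] fq by auto
    then obtain m where "(\<Union>S\<in>queries (snd r). fst ` S) \<subseteq> {..<m}"
      using finite_nat_iff_bounded by blast
    then have "r \<in> ?B m" by blast
    then show "r \<in> (\<Union>m. ?B m)" by (rule UN_I[OF UNIV_I])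
  qed
  have "1 = emeasure (measure_spmf p) UNIV"
    by (rule emeasure_lossless_spmf[OF assms(1), symmetric])
  also have "\<dots> = emeasure (measure_spmf p) (\<Union>m. ?B m)"
  proof (rule emeasure_eq_AE)
    show "AE r in measure_spmf p. (r \<in> UNIV) = (r \<in> (\<Union>m. ?B m))"
      unfolding AE_measure_spmf_iff using sup by blast
  qed simp_all
  also have "\<dots> = (SUP m. emeasure (measure_spmf p) (?B m))"
    by (rule SUP_emeasure_incseq[symmetric]) (use mono in auto)
  finally have "(SUP m. emeasure (measure_spmf p) (?B m)) = 1" by simp
  moreover have "1 / 2 < (1 :: ennreal)"
    by (rule half_less_one)
  ultimately have "1 / 2 < (SUP m. emeasure (measure_spmf p) (?B m))"
    by simp
  then obtain m where m: "1 / 2 < emeasure (measure_spmf p) (?B m)"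
    by (auto simp: less_SUP_iff)
  let ?F = "\<lambda>b. {r. fst r \<noteq> b \<and> (\<forall>S\<in>queries (snd r). fst ` S \<subseteq> {..<m})}"
  have "?B m = ?F True \<union> ?F False" by auto
  then have "emeasure (measure_spmf p) (?B m) =
      emeasure (measure_spmf p) (?F True) + emeasure (measure_spmf p) (?F False)"
    by (subst plus_emeasure) auto
  with m have "1 / 2 < emeasure (measure_spmf p) (?F True) + emeasure (measure_spmf p) (?F False)"
    by simp
  then have "1 / 4 \<le> emeasure (measure_spmf p) (?F True) \<or> 1 / 4 \<le> emeasure (measure_spmf p) (?F False)"
    by (rule ennreal_half_quarter)
  then show ?thesis by blast
qed

section \<open>The adversary\<close>

text \<open>Links \<open>play\<close>, whose labels come from the target, with
  \<open>round_after\<close>, whose labels are prescribed.\<close>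

lemma zip_zero_ext:
  assumes "distinct xs" "length ys = length xs" "i \<le> length xs"
  shows "map (\<lambda>x. (x, zero_ext xs ys x)) (take i xs) = zip (take i xs) (take i ys)"
  using assms by (auto simp: list_eq_iff_nth_eq zero_ext_nth)

lemma hidden_class_append: "hidden_class d xs ys \<subseteq> hidden_class d (xs @ [x]) ys"
proof -
  have "branch (xs @ [x]) ys i = branch xs ys i" if "i < length xs" for i
    using that by (simp add: branch_def nth_append)
  then have "branch xs ys ` {..<length xs} = branch (xs @ [x]) ys ` {..<length xs}"
    by (intro image_cong) auto
  then show ?thesis by (auto simp: hidden_class_def)
qed

text \<open>The oracle in condition \<open>i\<close> depends on the points up to
  \<open>xs ! i\<close> and the labels below \<open>i\<close>. So \<open>ys ! i\<close> and
  \<open>M i\<close> can be read off the law of that round, and later choices leave the condition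
  unchanged.\<close>

lemma adversarial_sequence:
  fixes A :: "nat learner"
  assumes d: "d \<ge> 1" and T: "2 ^ (d - 1) \<le> T"
    and A: "finite_query_learner UNIV (littlestone_family UNIV d) T A"
    and t: "t \<le> 2 ^ (d - 1)"
  shows "\<exists>xs ys M. length xs = t \<and> length ys = t \<and> distinct xs \<and> set xs \<subseteq> {d..} \<and>
    (\<forall>i j. i < j \<longrightarrow> j < t \<longrightarrow> M i \<le> xs ! j) \<and>
    (\<forall>i<t. 1 / 4 \<le> emeasure (measure_spmf
       (round_after A (lazy_erm d (take (Suc i) xs) (take i ys)) (zip (take i xs) (take i ys)) (xs ! i) []))
       {r. fst r \<noteq> ys ! i \<and> (\<forall>S\<in>queries (snd r). fst ` S \<subseteq> {..<M i})})"
  using t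
proof (induction t)
  case 0
  show ?case by simp
next
  case (Suc t)
  then obtain xs ys M where l: "length xs = t" "length ys = t" and dist: "distinct xs"
    and high: "set xs \<subseteq> {d..}" and fresh: "\<And>i j. i < j \<Longrightarrow> j < t \<Longrightarrow> M i \<le> xs ! j"
    and mist: "\<And>i. i < t \<Longrightarrow> 1 / 4 \<le> emeasure (measure_spmf
       (round_after A (lazy_erm d (take (Suc i) xs) (take i ys)) (zip (take i xs) (take i ys)) (xs ! i) []))
       {r. fst r \<noteq> ys ! i \<and> (\<forall>S\<in>queries (snd r). fst ` S \<subseteq> {..<M i})}"
    by auto
  \<comment> \<open>The sums dominate each \<open>M i\<close> and each earlier point; the final 1
    makes \<open>x\<close> new.\<close>
  define x where "x = d + sum M {..<t} + sum_list xs + 1"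
  have x: "d \<le> x" "x \<notin> set xs" "\<And>i. i < t \<Longrightarrow> M i \<le> x"
  proof -
    show "d \<le> x" by (simp add: x_def)
    show "x \<notin> set xs" using member_le_sum_list[of x xs] by (auto simp: x_def)
    show "M i \<le> x" if "i < t" for i
      using member_le_sum[of i "{..<t}" M] that by (simp add: x_def)
  qed
  let ?xs = "xs @ [x]" and ?pad = "replicate (T - Suc t) 0"
  let ?C = "hidden_class d ?xs ys" and ?erm = "lazy_erm d ?xs ys" and ?c = "zero_ext xs ys"
  \<comment> \<open>The class with the label of \<open>x\<close> still open is itself in the family.
    So the learner terminates almost surely against it on plays of length \<open>T\<close>, the
    reason for the padding.\<close>
  have "?C \<in> littlestone_family UNIV d"
    by (rule hidden_class_in_family[OF d]) (use high x(1) l Suc.prems in auto)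
  moreover have "agnostic_erm UNIV ?C ?erm"
    by (rule agnostic_erm_lazy_erm) (simp add: l)
  moreover have "?c \<in> ?C"
    using zero_ext_in_hidden_class[of ys xs d] hidden_class_append[of d xs ys x] l by blast
  moreover have "length (xs @ x # ?pad) = T"
    using l T Suc.prems by simp
  ultimately have "lossless_spmf (play A ?erm ?c (xs @ x # ?pad) [])"
    using A unfolding finite_query_learner_def by blast
  then have "lossless_spmf (round_after A ?erm (map (\<lambda>x. (x, ?c x)) xs) x [])"
    by (rule lossless_round_after)
  then have loss: "lossless_spmf (round_after A ?erm (zip xs ys) x [])"
    using zip_zero_ext[OF dist, of ys t] l by simp
  have "\<exists>b m. 1 / 4 \<le> emeasure (measure_spmf (round_after A ?erm (zip xs ys) x []))
      {r. fst r \<noteq> b \<and> (\<forall>S\<in>queries (snd r). fst ` S \<subseteq> {..<m})}"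
  proof (rule likely_bounded_queries[OF loss])
    fix r S assume "r \<in> set_spmf (round_after A ?erm (zip xs ys) x [])" "S \<in> queries (snd r)"
    with set_round_after obtain g where "Query S \<in> set_pmf (A g)" by fastforce
    with A show "finite S" unfolding finite_query_learner_def by blast
  qed
  then obtain b m where bm: "1 / 4 \<le> emeasure (measure_spmf (round_after A ?erm (zip xs ys) x []))
      {r. fst r \<noteq> b \<and> (\<forall>S\<in>queries (snd r). fst ` S \<subseteq> {..<m})}" by blast
  show ?case
  proof (intro exI[of _ ?xs] exI[of _ "ys @ [b]"] exI[of _ "M(t := m)"] conjI allI impI)
    show "(M(t := m)) i \<le> ?xs ! j" if "i < j" "j < Suc t" for i j
      using that fresh[of i j] x(3)[of i] l by (auto simp: nth_append less_Suc_eq)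
    show "1 / 4 \<le> emeasure (measure_spmf
       (round_after A (lazy_erm d (take (Suc i) ?xs) (take i (ys @ [b])))
         (zip (take i ?xs) (take i (ys @ [b]))) (?xs ! i) []))
       {r. fst r \<noteq> (ys @ [b]) ! i \<and> (\<forall>S\<in>queries (snd r). fst ` S \<subseteq> {..<(M(t := m)) i})}"
      if "i < Suc t" for i
    proof (cases "i = t")
      case True
      with bm l show ?thesis by (simp add: nth_append)
    next
      case False
      with that have i: "i < t" by simp
      with mist[OF i] l show ?thesis by (simp add: nth_append)
    qed
  qed (use l dist high x in auto)
qed

text \<open>Each of the \<open>2 ^ (d - 1)\<close> hidden points costs 1/4, which gives the constant
  1/8.\<close>

lemma worst_case_mistakes_ge:
  fixes A :: "nat learner"
  assumes d: "d \<ge> 1" and T: "2 ^ (d - 1) \<le> T"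
    and A: "finite_query_learner UNIV (littlestone_family UNIV d) T A"
  shows "ennreal (1 / 8 * 2 ^ d) \<le> worst_case_mistakes UNIV (littlestone_family UNIV d) A T"
proof -
  define N where "N = (2 ^ (d - 1) :: nat)"
  from adversarial_sequence[OF d T A, of N] obtain xs ys M where l: "length xs = N" "length ys = N"
    and dist: "distinct xs" and high: "set xs \<subseteq> {d..}"
    and fresh: "\<And>i j. i < j \<Longrightarrow> j < N \<Longrightarrow> M i \<le> xs ! j"
    and mist: "\<And>i. i < N \<Longrightarrow> 1 / 4 \<le> emeasure (measure_spmf
       (round_after A (lazy_erm d (take (Suc i) xs) (take i ys)) (zip (take i xs) (take i ys)) (xs ! i) []))
       {r. fst r \<noteq> ys ! i \<and> (\<forall>S\<in>queries (snd r). fst ` S \<subseteq> {..<M i})}"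
    unfolding N_def by auto
  let ?C = "hidden_class d xs ys" and ?erm = "lazy_erm d xs ys" and ?c = "zero_ext xs ys"
  let ?zs = "xs @ replicate (T - N) 0"
  let ?p = "\<lambda>i. measure_spmf
      (round_after A ?erm (map (\<lambda>x. (x, ?c x)) (take i ?zs)) (?zs ! i) [])"
  have C: "?C \<in> littlestone_family UNIV d"
    by (rule hidden_class_in_family[OF d high]) (simp add: l N_def)
  have erm: "agnostic_erm UNIV ?C ?erm"
    by (rule agnostic_erm_lazy_erm) (simp add: l)
  have c: "?c \<in> ?C"
    by (rule zero_ext_in_hidden_class) (simp add: l)
  have len: "length ?zs = T"
    using l T by (simp add: N_def)
  have loss: "lossless_spmf (play A ?erm ?c ?zs [])"
    using A C erm c len unfolding finite_query_learner_def by blast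
  have round: "ennreal (1 / 4) \<le> emeasure (?p i) {r. fst r \<noteq> ?c (?zs ! i)}" if i: "i < N" for i
  proof -
    let ?B = "{r :: bool \<times> nat event list. fst r \<noteq> ys ! i \<and> (\<forall>S\<in>queries (snd r). fst ` S \<subseteq> {..<M i})}"
    have z: "?zs ! i = xs ! i" "take i ?zs = take i xs"
      using i l by (simp_all add: nth_append)
    have "ennreal (1 / 4) \<le> emeasure (measure_spmf (round_after A
        (lazy_erm d (take (Suc i) xs) (take i ys)) (zip (take i xs) (take i ys)) (xs ! i) [])) ?B"
      using mist[OF i] ennreal_divide_numeral[of 1 "num.Bit0 (num.Bit0 num.One)"] by simp
    also have "\<dots> = emeasure (measure_spmf (round_after A ?erm
        (zip (take i xs) (take i ys)) (xs ! i) [])) ?B"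
    proof (rule emeasure_spmf_cong)
      fix r assume r: "r \<in> ?B"
      \<comment> \<open>On \<open>?B\<close> all queried points are below \<open>M i\<close>, while
        hidden points after index \<open>i\<close> are at least \<open>M i\<close>. Hence the final
        oracle answers like the one that ignores \<open>ys ! i\<close>.\<close>
      have "\<forall>S\<in>queries (snd r). lazy_erm d (take (Suc i) xs) (take i ys) S = ?erm S"
      proof (intro ballI lazy_erm_prefix[symmetric])
        fix S j assume "S \<in> queries (snd r)" "i < j" "j < length xs"
        with r fresh[of i j] l show "xs ! j \<notin> fst ` S" by fastforce
      qed (use i l in simp)
      then show "spmf (round_after A (lazy_erm d (take (Suc i) xs) (take i ys))
          (zip (take i xs) (take i ys)) (xs ! i) []) r =
        spmf (round_after A ?erm (zip (take i xs) (take i ys)) (xs ! i) []) r"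
        using spmf_round_after_cong[of "snd r" _ _ A _ _ _ "fst r"] by (simp only: prod.collapse)
    qed
    also have "\<dots> = emeasure (?p i) ?B"
      unfolding z using zip_zero_ext[OF dist, of ys i] i l by simp
    also have "\<dots> \<le> emeasure (?p i) {r. fst r \<noteq> ?c (?zs ! i)}"
      unfolding z using zero_ext_nth[OF dist, of i ys] i l by (intro emeasure_mono) auto
    finally show ?thesis .
  qed
  have "real (2 ^ d) = 2 * real N"
    using d by (cases d) (simp_all add: N_def)
  moreover have "(\<Sum>i<N. ennreal (1 / 4)) = ennreal (\<Sum>i<N. 1 / 4)"
    by (rule sum_ennreal) simp
  ultimately have "ennreal (1 / 8 * 2 ^ d) = (\<Sum>i<N. ennreal (1 / 4))"
    by simp
  also have "\<dots> \<le> (\<Sum>i<N. emeasure (?p i) {r. fst r \<noteq> ?c (?zs ! i)})"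
    using round by (intro sum_mono) auto
  \<comment> \<open>Rounds on the padding can only add mistakes.\<close>
  also have "\<dots> \<le> (\<Sum>i<length ?zs. emeasure (?p i) {r. fst r \<noteq> ?c (?zs ! i)})"
    using l by (intro sum_mono2) auto
  also have "\<dots> \<le> expected_mistakes A ?erm ?c ?zs"
    unfolding expected_mistakes_def by (rule sum_round_mistakes_le[OF loss])
  also have "\<dots> \<le> worst_case_mistakes UNIV (littlestone_family UNIV d) A T"
    unfolding worst_case_mistakes_def
    by (rule SUP_upper2[OF C], rule SUP_upper2[of ?erm], simp add: erm,
        rule SUP_upper2[OF c], rule SUP_upper) (use len in simp)
  finally show ?thesis .
qed

theorem theorem3p1:
  "\<exists>c::real. c > 0 \<and>
     (\<forall>d::nat. d \<ge> 1 \<longrightarrow>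
       (\<exists>X :: nat set. \<exists>T0::nat. \<forall>T\<ge>T0. \<forall>A :: nat learner.
          finite_query_learner X (littlestone_family X d) T A \<longrightarrow>
          worst_case_mistakes X (littlestone_family X d) A T \<ge> ennreal (c * 2 ^ d)))"
proof (intro exI[of _ "1 / 8"] conjI allI impI)
  fix d :: nat
  assume d: "d \<ge> 1"
  show "\<exists>X :: nat set. \<exists>T0::nat. \<forall>T\<ge>T0. \<forall>A :: nat learner.
      finite_query_learner X (littlestone_family X d) T A \<longrightarrow>
      worst_case_mistakes X (littlestone_family X d) A T \<ge> ennreal (1 / 8 * 2 ^ d)"
    \<comment> \<open>The horizon must hold all \<open>2 ^ (d - 1)\<close> hidden points.\<close>
    using worst_case_mistakes_ge[OF d] by (intro exI[of _ UNIV] exI[of _ "2 ^ (d - 1)"]) blast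
qed simp

end
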